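(* Let $\mathcal{C}$ be a frieze with coefficients on an $n$-gon over the positive integers. Then $\mathcal{C}$ appears as a subpolygon of some Conway-Coxeter frieze if and only if the following two conditions are satisfied: (1) for any triangle in $\mathcal{C}$, with labels $a,b,c$ of its three sides, we have $\gcd(a,b)=\gcd(b,c)=\gcd(a,c)$; (2) for every prime number $p<n$ and every $(p+1)$-subpolygon $\mathcal{D}$ of $\mathcal{C}$, the labels of the edges and diagonals of $\mathcal{D}$ are either all not divisible by $p$, or they do not all have the same $p$-valuation.
   Context: Label the vertices of a regular $n$-gon by $0,1,\dots,n-1$ in cyclic (counterclockwise) order. A frieze with coefficients on the $n$-gon over a set $R$ is a map $\mathcal{C}$ assigning to each edge or diagonal $\{i,j\}$ ($i\neq j$) a value $c_{i,j}=c_{j,i}\in R$ such that all Ptolemy relations hold: $c_{i,k}c_{j,\ell}=c_{i,\ell}c_{j,k}+c_{i,j}c_{k,\ell}$ for all vertices $i<j<k<\ell$. (Equivalently, a tame frieze pattern with coefficients of height $n-3$; over the positive integers all such are tame.) A subpolygon of $\mathcal{C}$ on a subset $S$ of $k$ vertices is the restriction of $\mathcal{C}$ to the edges and diagonals of the $k$-gon with vertex set $S$ (in inherited cyclic order); it is again a frieze with coefficients. A triangle in $\mathcal{C}$ is a 3-subpolygon. A Conway-Coxeter frieze is a frieze with coefficients over the positive integers on some polygon in which every boundary edge $\{i,i+1\}$ (indices mod the number of vertices) has label $1$. $\mathcal{C}$ appears as a subpolygon of a Conway-Coxeter frieze $\mathcal{E}$ if $\mathcal{C}$ coincides (after relabelling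 vertices preserving cyclic order) with a subpolygon of $\mathcal{E}$. The $p$-valuation $\nu_p(u)$ of a positive integer $u$ is the exponent of $p$ in $u$. *)

theory Defs
  imports "HOL-Computational_Algebra.Primes"
begin

text \<open>
  The vertices of the \<open>n\<close>-gon are the numbers \<open>0, \<dots>, n - 1\<close>, and a labelling of its edges and
  diagonals is a function \<open>c\<close> on pairs of vertices. Only the values \<open>c i j\<close> with \<open>i, j < n\<close> and
  \<open>i \<noteq> j\<close> carry meaning.
\<close>

definition frieze :: "'a::comm_semiring set \<Rightarrow> nat \<Rightarrow> (nat \<Rightarrow> nat \<Rightarrow> 'a) \<Rightarrow> bool" where
  "frieze R n c \<longleftrightarrow>
     n \<ge> 3 \<and>
     (\<forall>i<n. \<forall>j<n. i \<noteq> j \<longrightarrow> c i j \<in> R \<and> c i j = c j i) \<and>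
     (\<forall>i j k l. i < j \<and> j < k \<and> k < l \<and> l < n \<longrightarrow>
        c i k * c j l = c i l * c j k + c i j * c k l)"

definition conway_coxeter_frieze :: "nat \<Rightarrow> (nat \<Rightarrow> nat \<Rightarrow> nat) \<Rightarrow> bool" where
  "conway_coxeter_frieze m e \<longleftrightarrow>
     frieze {0<..} m e \<and> (\<forall>i<m. e i ((i + 1) mod m) = 1)"

definition cyclically_ordered :: "nat \<Rightarrow> nat \<Rightarrow> nat \<Rightarrow> bool" where
  "cyclically_ordered i j k \<longleftrightarrow> i < j \<and> j < k \<or> j < k \<and> k < i \<or> k < i \<and> i < j"

text \<open>
  The labelling \<open>c\<close> of the \<open>n\<close>-gon coincides, after a relabelling \<open>f\<close> of the vertices that
  preserves the cyclic order, with the restriction of the labelling \<open>e\<close> of the \<open>m\<close>-gon to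
  the vertex set \<open>S\<close>.
\<close>

definition appears_as_subpolygon ::
    "nat \<Rightarrow> (nat \<Rightarrow> nat \<Rightarrow> 'a) \<Rightarrow> nat \<Rightarrow> (nat \<Rightarrow> nat \<Rightarrow> 'a) \<Rightarrow> bool" where
  "appears_as_subpolygon n c m e \<longleftrightarrow>
     (\<exists>S f. S \<subseteq> {..<m} \<and> bij_betw f {..<n} S \<and>
        (\<forall>i<n. \<forall>j<n. \<forall>k<n. cyclically_ordered i j k \<longrightarrow> cyclically_ordered (f i) (f j) (f k)) \<and>
        (\<forall>i<n. \<forall>j<n. i \<noteq> j \<longrightarrow> c i j = e (f i) (f j)))"

definition subpolygon_labels :: "(nat \<Rightarrow> nat \<Rightarrow> 'a) \<Rightarrow> nat set \<Rightarrow> 'a set" where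
  "subpolygon_labels c S = {c i j | i j. i \<in> S \<and> j \<in> S \<and> i \<noteq> j}"

end

theory Submission
  imports Defs "HOL-Number_Theory.Cong" "HOL-Library.Product_Plus"
begin

text \<open>
  A frieze is a subpolygon of a Conway-Coxeter frieze iff its labels are the determinants of
  primitive integer vectors \<open>V 0, V 1, \<dots>\<close> of the plane. In one direction, such a sequence is
  refined by inserting lattice vectors until consecutive determinants are \<open>1\<close>. In the other,
  a Conway-Coxeter frieze is represented by the vectors \<open>(- e 1 j, e 0 j)\<close>.

  For primitive vectors the triangle condition is immediate, and the condition at \<open>p\<close> says that
  the affine line over the field with \<open>p\<close> elements has only \<open>p\<close> points. Conversely, one may
  normalise \<open>V 0 = (1, 0)\<close> and \<open>V 1 = (x, c 0 1)\<close>; then \<open>V j\<close> must be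
  \<open>((x * c 0 j - c 1 j) / c 0 1, c 0 j)\<close>, and only the integer \<open>x\<close> is to be found. Integrality and
  primitivity are congruence conditions on \<open>x\<close> modulo powers of the primes dividing \<open>c 0 1\<close>.
  They are solved one prime at a time and combined by the Chinese remainder theorem.
\<close>

section \<open>Determinants and primitive vectors of the plane\<close>

definition det2 :: "int \<times> int \<Rightarrow> int \<times> int \<Rightarrow> int" where
  "det2 u v = fst u * snd v - fst v * snd u"

definition primitive :: "int \<times> int \<Rightarrow> bool" where
  "primitive u \<longleftrightarrow> coprime (fst u) (snd u)"

lemma det2_self [simp]: "det2 u u = 0"
  by (simp add: det2_def)

lemma det2_swap: "det2 u v = - det2 v u"
  by (simp add: det2_def)

lemma det2_uminus_right [simp]: "det2 u (- v) = - det2 u v"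
  by (simp add: det2_def)

text \<open>The Ptolemy relation for the vertices \<open>u\<close>, \<open>v\<close>,
  \<open>w\<close>, \<open>z\<close>, as a polynomial identity in signed determinants.\<close>

lemma det2_plucker: "det2 u w * det2 v z = det2 u z * det2 v w + det2 u v * det2 w z"
  by (simp add: det2_def algebra_simps)

text \<open>Bezout's identity. The partner \<open>s\<close> completes \<open>u\<close> to a basis of
  the lattice and so supplies coordinates.\<close>

lemma primitive_iff_det2: "primitive u \<longleftrightarrow> (\<exists>s. det2 u s = 1)"
proof
  assume "primitive u"
  then obtain a b where "a * fst u + b * snd u = 1"
    unfolding primitive_def by (metis coprime_iff_gcd_eq_1 bezout_int)
  then have "det2 u (-b, a) = 1"
    by (simp add: det2_def algebra_simps)
  then show "\<exists>s. det2 u s = 1" ..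
next
  assume "\<exists>s. det2 u s = 1"
  then obtain s where s: "det2 u s = 1" ..
  show "primitive u"
    unfolding primitive_def
  proof (rule coprimeI)
    fix d assume "d dvd fst u" "d dvd snd u"
    then have "d dvd det2 u s" unfolding det2_def by simp
    then show "is_unit d" using s by simp
  qed
qed

text \<open>With a partner \<open>s\<close> of \<open>v\<close>, the Pluecker identity writes
  \<open>det2 u w\<close> as an integer combination of \<open>det2 v w\<close> and
  \<open>det2 v u\<close>. For primitive vectors this is the triangle condition.\<close>

lemma dvd_det2_trans:
  assumes "primitive v" "d dvd det2 v u" "d dvd det2 v w"
  shows "d dvd det2 u w"
proof -
  obtain s where s: "det2 v s = 1"
    using assms(1) primitive_iff_det2 by blast
  have "det2 v s * det2 u w = det2 v w * det2 u s + det2 v u * det2 s w"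
    by (rule det2_plucker)
  with s assms(2,3) show ?thesis
    by simp
qed

text \<open>With \<open>v\<close> a vector of the subpolygon and \<open>det2 v s = 1\<close>, the other vectors are
  \<open>a\<^sub>i v + p\<^sup>r b\<^sub>i s\<close> with \<open>a\<^sub>i\<close> invertible modulo \<open>p\<close>, and the quotients
  \<open>b\<^sub>i / a\<^sub>i\<close> are pairwise distinct modulo \<open>p\<close>.\<close>

lemma card_equidistant_vectors_le:
  fixes p r :: nat
  assumes p: "prime p" and S: "finite S" "S \<noteq> {}"
    and prim: "\<And>i. i \<in> S \<Longrightarrow> primitive (V i)"
    and r: "r \<ge> 1"
    and dvd: "\<And>i j. i \<in> S \<Longrightarrow> j \<in> S \<Longrightarrow> int p ^ r dvd det2 (V i) (V j)"
    and ndvd: "\<And>i j. i \<in> S \<Longrightarrow> j \<in> S \<Longrightarrow> i \<noteq> j \<Longrightarrow> \<not> int p ^ Suc r dvd det2 (V i) (V j)"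
  shows "card S \<le> p"
proof -
  have pi: "prime (int p)" and p0: "int p > 0"
    using p by (simp_all add: prime_gt_0_nat)
  obtain o0 where o: "o0 \<in> S" using S by blast
  obtain s where s: "det2 (V o0) s = 1"
    using prim[OF o] primitive_iff_det2 by blast
  define a where "a i = det2 (V i) s" for i
  obtain b where b: "\<And>i. i \<in> S \<Longrightarrow> det2 (V o0) (V i) = int p ^ r * b i"
    using dvd[OF o] unfolding dvd_def by metis
  \<comment> \<open>\<open>a i\<close> and \<open>int p ^ r * b i\<close> are the coordinates of
    \<open>V i\<close> in the basis \<open>V o0\<close>, \<open>s\<close>.\<close>
  have comb: "det2 (V i) (V j) = int p ^ r * (a i * b j - a j * b i)" if "i \<in> S" "j \<in> S" for i j
    using det2_plucker[of "V o0" "V i" s "V j"] det2_plucker[of "V o0" s "V i" "V j"] b[OF that(1)] b[OF that(2)] s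
    by (simp add: a_def algebra_simps det2_swap[of s])
  \<comment> \<open>As \<open>r\<close> is positive, \<open>p\<close> divides
    \<open>det2 (V i) (V o0)\<close>. If it also divided \<open>a i\<close>, transitivity through
    \<open>V i\<close> would make it divide \<open>det2 (V o0) s = 1\<close>.\<close>
  have "coprime (a i) (int p)" if i: "i \<in> S" for i
  proof (rule ccontr)
    assume "\<not> coprime (a i) (int p)"
    then have "int p dvd a i"
      using prime_imp_coprime[OF pi] coprime_commute by blast
    moreover have "int p dvd det2 (V i) (V o0)"
      using dvd[OF i o] r by (meson dvd_power dvd_trans less_le_trans zero_less_one)
    ultimately have "int p dvd det2 (V o0) s"
      using dvd_det2_trans prim[OF i] unfolding a_def by blast
    with s pi show False by (simp add: prime_int_iff)
  qed
  then have "\<forall>i\<in>S. \<exists>q. [a i * q = 1] (mod int p)"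
    using coprime_iff_invertible_int by blast
  then obtain q where q: "\<And>i. i \<in> S \<Longrightarrow> [a i * q i = 1] (mod int p)"
    by metis
  define g where "g i = (b i * q i) mod int p" for i
  have "inj_on g S"
  proof (rule inj_onI, rule ccontr)
    fix i j assume i: "i \<in> S" and j: "j \<in> S" and g: "g i = g j" and ne: "i \<noteq> j"
    have c: "[b i * q i = b j * q j] (mod int p)"
      using g by (simp add: g_def cong_def)
    have "[(a j * q j) * (a i * b j) = 1 * (a i * b j)] (mod int p)"
         "[(a i * q i) * (a j * b i) = 1 * (a j * b i)] (mod int p)"
      by (rule cong_scalar_right[OF q[OF j]], rule cong_scalar_right[OF q[OF i]])
    moreover have "[(a i * a j) * (b i * q i) = (a i * a j) * (b j * q j)] (mod int p)"
      using c by (rule cong_scalar_left)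
    ultimately have "[a i * b j = a j * b i] (mod int p)"
      by (simp add: ac_simps cong_def)
    then have "int p dvd a i * b j - a j * b i"
      by (simp add: cong_iff_dvd_diff)
    then have "int p ^ Suc r dvd det2 (V i) (V j)"
      unfolding comb[OF i j] by (simp add: mult.commute mult_dvd_mono)
    with ndvd[OF i j ne] show False ..
  qed
  moreover have "g ` S \<subseteq> {0..<int p}"
    using p0 by (auto simp: g_def)
  ultimately have "card S \<le> card {0..<int p}"
    by (intro card_inj_on_le) auto
  then show ?thesis by simp
qed

section \<open>Refining a fan of vectors until consecutive determinants are 1\<close>

text \<open>Bookkeeping for the measure in \<open>vector_fan_refine\<close>: an inserted vector
  splits the gap at \<open>i\<close> in two and shifts the later gaps by one place.\<close>

lemma sum_insert_gap:
  fixes g :: "nat \<Rightarrow> int"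
  assumes "i < n"
  shows "(\<Sum>j<Suc n. if j < i then g j else if j = i then a else if j = Suc i then b else g (j - 1))
    = (\<Sum>j<n. g j) - g i + a + b"
  using assms
proof (induction n)
  case (Suc n)
  show ?case
  proof (cases "i = n")
    case True
    then show ?thesis by simp
  next
    case False
    with Suc show ?thesis by simp
  qed
qed simp

text \<open>The extra vector \<open>V n = - V 0\<close> turns the edge from \<open>n - 1\<close> back to \<open>0\<close> into an ordinary
  consecutive pair.\<close>

definition vector_fan :: "nat \<Rightarrow> (nat \<Rightarrow> int \<times> int) \<Rightarrow> bool" where
  "vector_fan n V \<longleftrightarrow> n \<ge> 3 \<and> (\<forall>i\<le>n. primitive (V i)) \<and> V n = - V 0 \<and>
     (\<forall>i j. i < j \<and> j \<le> n \<and> (i, j) \<noteq> (0, n) \<longrightarrow> det2 (V i) (V j) > 0)"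

text \<open>A partner \<open>s\<close> of \<open>u\<close> may be changed by multiples of
  \<open>u\<close>, which reduces \<open>det2 s v\<close> modulo \<open>D = det2 u v\<close>. The
  residue is not 0: otherwise \<open>D > 1\<close> would divide \<open>det2 u w = 1\<close>, by
  transitivity through the primitive \<open>v\<close>.\<close>

lemma exists_intermediate_vector:
  assumes "primitive u" "primitive v" "det2 u v > 1"
  shows "\<exists>w. det2 u w = 1 \<and> 0 < det2 w v \<and> det2 w v < det2 u v"
proof -
  obtain s where s: "det2 u s = 1"
    using assms(1) primitive_iff_det2 by blast
  define D where "D = det2 u v"
  define t where "t = det2 s v div D"
  define w where "w = (fst s - t * fst u, snd s - t * snd u)"
  have uw: "det2 u w = 1"
    using s by (simp add: w_def det2_def algebra_simps)
  have "det2 w v = det2 s v - t * D"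
    by (simp add: w_def D_def det2_def algebra_simps)
  then have wv: "det2 w v = det2 s v mod D"
    by (simp add: t_def minus_div_mult_eq_mod)
  have "D > 1" using assms by (simp add: D_def)
  then have "det2 w v \<ge> 0" "det2 w v < D" using wv by simp_all
  moreover have "det2 w v \<noteq> 0"
  proof
    assume 0: "det2 w v = 0"
    have "D dvd det2 v u" by (simp add: D_def det2_swap[of v])
    moreover have "D dvd det2 v w" using 0 by (simp add: det2_swap[of v])
    ultimately have "D dvd det2 u w"
      by (rule dvd_det2_trans[OF assms(2)])
    with uw \<open>D > 1\<close> show False by simp
  qed
  ultimately have "0 < det2 w v" "det2 w v < det2 u v"
    by (simp_all add: D_def)
  with uw show ?thesis by blast
qed

text \<open>The multiple of \<open>w\<close> by \<open>det2 (V i) (V (Suc i))\<close> is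
  \<open>det2 w (V (Suc i))\<close> times \<open>V i\<close> plus \<open>V (Suc i)\<close>. So
  \<open>w\<close> lies strictly inside the cone of its neighbours, and its determinants with the
  other vectors inherit their sign.\<close>

lemma vector_fan_insert:
  assumes fan: "vector_fan n V" and i: "i < n"
    and w: "det2 (V i) w = 1" "0 < det2 w (V (Suc i))" and D: "det2 (V i) (V (Suc i)) > 0"
  shows "vector_fan (Suc n) (\<lambda>j. if j \<le> i then V j else if j = Suc i then w else V (j - 1))"
proof -
  let ?W = "\<lambda>j. if j \<le> i then V j else if j = Suc i then w else V (j - 1)"
  let ?D = "det2 (V i) (V (Suc i))"
  have n: "n \<ge> 3" and prim: "\<And>j. j \<le> n \<Longrightarrow> primitive (V j)" and Vn: "V n = - V 0"
    and pos: "\<And>j l. j < l \<Longrightarrow> l \<le> n \<Longrightarrow> (j, l) \<noteq> (0, n) \<Longrightarrow> det2 (V j) (V l) > 0"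
    using fan unfolding vector_fan_def by auto
  \<comment> \<open>The pair \<open>(0, n)\<close> has determinant 0. A weak inequality is enough
    for one of the two summands in \<open>before\<close> and \<open>after\<close>.\<close>
  have nonneg: "det2 (V j) (V l) \<ge> 0" if "j \<le> l" "l \<le> n" for j l
  proof (cases "j = l \<or> (j, l) = (0, n)")
    case True then show ?thesis using Vn by auto
  next
    case False then show ?thesis using pos[of j l] that by auto
  qed
  have primw: "primitive w"
  proof -
    have "det2 w (- V i) = 1" using w(1) by (simp add: det2_swap[of w])
    then show ?thesis using primitive_iff_det2 by blast
  qed
  have before: "det2 (V j) w > 0" if "j \<le> i" for j
  proof (cases "j = i")
    case False
    have eq: "?D * det2 (V j) w = det2 w (V (Suc i)) * det2 (V j) (V i) + det2 (V j) (V (Suc i))"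
      using det2_plucker[of "V j" "V i" w "V (Suc i)"] w(1)
      by (simp add: algebra_simps det2_swap[of w "V i"])
    have "det2 (V j) (V i) > 0" using pos[of j i] that False i by auto
    moreover have "det2 (V j) (V (Suc i)) \<ge> 0" using nonneg[of j "Suc i"] that i by auto
    ultimately have "?D * det2 (V j) w > 0"
      unfolding eq using w(2) by (simp add: add_pos_nonneg)
    then show ?thesis using D by (simp add: zero_less_mult_iff)
  qed (use w in auto)
  have after: "det2 w (V l) > 0" if "Suc i \<le> l" "l \<le> n" for l
  proof (cases "l = Suc i")
    case False
    have eq: "?D * det2 w (V l) = det2 w (V (Suc i)) * det2 (V i) (V l) + det2 (V (Suc i)) (V l)"
      using det2_plucker[of "V i" "V (Suc i)" w "V l"] w(1)
      by (simp add: algebra_simps)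
    have "det2 (V (Suc i)) (V l) > 0" using pos[of "Suc i" l] that False i by auto
    moreover have "det2 (V i) (V l) \<ge> 0" using nonneg[of i l] that i by auto
    ultimately have "?D * det2 w (V l) > 0"
      unfolding eq using w(2) by (simp add: add_nonneg_pos)
    then show ?thesis using D by (simp add: zero_less_mult_iff)
  qed (use w in auto)
  have posW: "det2 (?W j) (?W l) > 0" if jl: "j < l" "l \<le> Suc n" "(j, l) \<noteq> (0, Suc n)" for j l
  proof -
    consider "l \<le> i" | "j \<le> i" "l = Suc i" | "j \<le> i" "l > Suc i" | "j = Suc i" "l > Suc i"
      | "j > Suc i" "l > Suc i" using jl by linarith
    then show ?thesis
    proof cases
      case 1 then show ?thesis using pos[of j l] jl i by auto
    next
      case 2 then show ?thesis using before by auto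
    next
      case 3
      then have "j < l - 1" "l - 1 \<le> n" "(j, l - 1) \<noteq> (0, n)" using jl by auto
      then have "det2 (V j) (V (l - 1)) > 0" by (rule pos)
      with 3 show ?thesis by simp
    next
      case 4 then show ?thesis using after[of "l - 1"] jl by auto
    next
      case 5 then show ?thesis using pos[of "j - 1" "l - 1"] jl by auto
    qed
  qed
  show ?thesis
    unfolding vector_fan_def
  proof (intro conjI allI impI)
    show "3 \<le> Suc n" using n by simp
    show "primitive (?W j)" if "j \<le> Suc n" for j
      using that prim[of j] prim[of "j - 1"] primw i by auto
    show "?W (Suc n) = - ?W 0" using i Vn by auto
    show "det2 (?W j) (?W l) > 0" if "j < l \<and> l \<le> Suc n \<and> (j, l) \<noteq> (0, Suc n)" for j l
      using that by (intro posW) blast+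
  qed
qed

text \<open>Induction on the total excess of the consecutive determinants over 1. Inserting an
  intermediate vector replaces one excess by 0 and a smaller one.\<close>

lemma vector_fan_refine:
  assumes "vector_fan n V"
  shows "\<exists>m W f. vector_fan m W \<and> (\<forall>i<m. det2 (W i) (W (Suc i)) = 1) \<and>
    strict_mono_on {..<n} f \<and> f ` {..<n} \<subseteq> {..<m} \<and> (\<forall>i<n. W (f i) = V i)"
  using assms
proof (induction "nat (\<Sum>i<n. det2 (V i) (V (Suc i)) - 1)" arbitrary: n V rule: less_induct)
  case less
  have n: "n \<ge> 3" and prim: "\<And>j. j \<le> n \<Longrightarrow> primitive (V j)"
    and pos': "\<And>j l. j < l \<Longrightarrow> l \<le> n \<Longrightarrow> (j, l) \<noteq> (0, n) \<Longrightarrow> det2 (V j) (V l) > 0"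
    using less.prems unfolding vector_fan_def by auto
  have pos: "det2 (V j) (V (Suc j)) > 0" if "j < n" for j
    using that n by (intro pos') auto
  show ?case
  proof (cases "\<forall>i<n. det2 (V i) (V (Suc i)) = 1")
    case True
    then show ?thesis using less.prems
      by (intro exI[of _ n] exI[of _ V] exI[of _ "\<lambda>i. i"]) (auto simp: strict_mono_on_def)
  next
    case False
    then obtain i where i: "i < n" "det2 (V i) (V (Suc i)) \<noteq> 1" by blast
    with pos[of i] have D: "det2 (V i) (V (Suc i)) > 1" by linarith
    obtain w where w: "det2 (V i) w = 1" "0 < det2 w (V (Suc i))"
      "det2 w (V (Suc i)) < det2 (V i) (V (Suc i))"
      using exists_intermediate_vector[OF _ _ D] prim i by auto
    define W where "W = (\<lambda>j. if j \<le> i then V j else if j = Suc i then w else V (j - 1))"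
    have fan: "vector_fan (Suc n) W"
      unfolding W_def using vector_fan_insert[OF less.prems i(1) w(1,2)] D by auto
    define g where "g = (\<lambda>j. det2 (V j) (V (Suc j)) - 1)"
    have "(\<Sum>j<Suc n. det2 (W j) (W (Suc j)) - 1) =
      (\<Sum>j<Suc n. if j < i then g j else if j = i then 0 else
        if j = Suc i then det2 w (V (Suc i)) - 1 else g (j - 1))"
      by (rule sum.cong) (use w in \<open>auto simp: W_def g_def\<close>)
    also have "\<dots> = (\<Sum>j<n. g j) - g i + 0 + (det2 w (V (Suc i)) - 1)"
      by (rule sum_insert_gap[OF i(1)])
    also have "\<dots> < (\<Sum>j<n. g j)" using w by (simp add: g_def)
    finally have lt: "(\<Sum>j<Suc n. det2 (W j) (W (Suc j)) - 1) < (\<Sum>j<n. g j)" .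
    \<comment> \<open>Since \<open>nat\<close> truncates at 0, a strict decrease of the measure
      requires the old sum to be positive.\<close>
    have "g j \<ge> 0" if "j < n" for j using pos[OF that] by (simp add: g_def)
    moreover have "g i > 0" using D by (simp add: g_def)
    ultimately have "(\<Sum>j<n. g j) > 0" using i by (intro sum_pos2[of _ i]) auto
    with lt have "nat (\<Sum>j<Suc n. det2 (W j) (W (Suc j)) - 1) < nat (\<Sum>j<n. g j)" by linarith
    from less.hyps[OF this[unfolded g_def] fan] obtain m W' f where
      f: "vector_fan m W'" "\<forall>i<m. det2 (W' i) (W' (Suc i)) = 1"
      "strict_mono_on {..<Suc n} f" "f ` {..<Suc n} \<subseteq> {..<m}" "\<forall>i<Suc n. W' (f i) = W i"
      by blast
    \<comment> \<open>The map \<open>h\<close> skips the position \<open>Suc i\<close> of the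
      inserted vector.\<close>
    define h where "h j = f (if j \<le> i then j else Suc j)" for j
    have "strict_mono_on {..<n} h"
      using f(3) unfolding strict_mono_on_def h_def by auto
    moreover have "f j < m" if "j < Suc n" for j using f(4) that by blast
    then have "h ` {..<n} \<subseteq> {..<m}" by (auto simp: h_def)
    moreover have "\<forall>j<n. W' (h j) = V j"
      using f(5) i by (auto simp: h_def W_def)
    ultimately show ?thesis using f(1,2) by blast
  qed
qed

section \<open>Solving the congruences at one prime\<close>

lemma prime_power_dvd_mult_cancel:
  fixes p :: int
  assumes "prime p" "\<not> p dvd a" "p ^ (r + k) dvd (p ^ r * a) * b"
  shows "p ^ k dvd b"
proof -
  have "p ^ r * p ^ k dvd p ^ r * (a * b)"
    using assms(3) by (simp add: power_add mult.assoc)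
  moreover have "p ^ r \<noteq> 0" using assms(1) by auto
  ultimately have "p ^ k dvd a * b" by (simp only: dvd_mult_cancel_left) simp
  moreover have "coprime (p ^ k) a"
    using assms(1,2) by (simp add: prime_imp_coprime)
  ultimately show ?thesis using coprime_dvd_mult_right_iff by blast
qed

text \<open>Here \<open>a j = c 0 j\<close>, \<open>b j = c 1 j\<close> and \<open>s j l = \<plusminus> c j l\<close>. Let \<open>R\<close> be the least valuation of the
  \<open>a j\<close>, attained at \<open>j0\<close>. A solution \<open>x0\<close> of the divisibility for \<open>j0\<close> solves it for all \<open>j\<close>, and
  \<open>x0 + q\<^sup>k\<^sup>-\<^sup>R y\<close> does so for every \<open>y\<close> as well. Non-divisibility is automatic where the
  valuation of \<open>a j\<close> exceeds \<open>R\<close>; each remaining \<open>j\<close> excludes one residue \<open>y\<close> modulo \<open>q\<close>. If all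
  residues were excluded, the excluding vertices together with \<open>0\<close> would form an equidistant
  \<open>(p + 1)\<close>-subpolygon.\<close>

lemma exists_local_solution:
  fixes p n :: nat and a b :: "nat \<Rightarrow> int" and s :: "nat \<Rightarrow> nat \<Rightarrow> int"
  defines "q \<equiv> int p"
  defines "k \<equiv> multiplicity q (a 1)"
  assumes p: "prime p" and n: "n \<ge> 2"
    and b1: "b 1 = 0"
    and a0: "\<And>j. j \<in> {1..<n} \<Longrightarrow> a j \<noteq> 0"
    and plucker: "\<And>j l. j \<in> {1..<n} \<Longrightarrow> l \<in> {1..<n} \<Longrightarrow> a 1 * s j l = a j * b l - a l * b j"
    and tri1: "\<And>d j l. j \<in> {1..<n} \<Longrightarrow> l \<in> {1..<n} \<Longrightarrow> d dvd a j \<Longrightarrow> d dvd a l \<Longrightarrow> d dvd s j l"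
    and tri2: "\<And>d j l. j \<in> {1..<n} \<Longrightarrow> l \<in> {1..<n} \<Longrightarrow> d dvd a j \<Longrightarrow> d dvd s j l \<Longrightarrow> d dvd a l"
    and equidistant: "\<And>T r. T \<subseteq> {1..<n} \<Longrightarrow> card T = p \<Longrightarrow> r \<ge> 1 \<Longrightarrow>
      (\<And>j. j \<in> T \<Longrightarrow> multiplicity q (a j) = r) \<Longrightarrow>
      (\<And>j l. j \<in> T \<Longrightarrow> l \<in> T \<Longrightarrow> j \<noteq> l \<Longrightarrow> multiplicity q (s j l) = r) \<Longrightarrow> False"
  shows "\<exists>x. \<forall>j\<in>{1..<n}. q ^ k dvd x * a j - b j \<and> (q dvd a j \<longrightarrow> \<not> q ^ Suc k dvd x * a j - b j)"
proof -
  let ?J = "{1..<n}"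
  have q: "prime q" and q0: "q > 0" and qu: "\<not> is_unit q" and qn: "q \<noteq> 0"
    using p unfolding q_def by (simp_all add: prime_gt_0_nat) (auto simp: prime_nat_iff)
  have one: "1 \<in> ?J" using n by simp
  define r where "r j = multiplicity q (a j)" for j
  have pw: "q ^ e dvd a j \<longleftrightarrow> e \<le> r j" if "j \<in> ?J" for e j
    unfolding r_def by (rule power_dvd_iff_le_multiplicity[OF a0[OF that] qu])
  have fac: "\<exists>A. a j = q ^ r j * A \<and> \<not> q dvd A" if j: "j \<in> ?J" for j
    unfolding r_def using multiplicity_decompose'[OF a0[OF j] qu] by metis
  obtain j0 where j0: "j0 \<in> ?J" and min: "\<And>j. j \<in> ?J \<Longrightarrow> r j0 \<le> r j"
    using one arg_min_least[of ?J _ r] arg_min_if_finite(1)[of ?J r] by (metis empty_iff finite_atLeastLessThan)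
  define R where "R = r j0"
  obtain A where A: "a j0 = q ^ R * A" "\<not> q dvd A" using fac[OF j0] by (auto simp: R_def)
  have rk: "r 1 = k" by (simp add: r_def k_def)
  have Rk: "R \<le> k" using min[OF one] rk by (simp add: R_def)
  obtain N where N: "a 1 = q ^ k * N" "\<not> q dvd N" using fac[OF one] rk by auto
  have Rdvd: "q ^ R dvd a j" if "j \<in> ?J" for j
    using pw[OF that] min[OF that] by (simp add: R_def)
  have s1: "s 1 l = b l" if "l \<in> ?J" for l
    using plucker[OF one that] b1 a0[OF one] by simp
  have "q ^ R dvd b j0"
    using tri1[OF one j0 Rdvd[OF one] Rdvd[OF j0]] s1[OF j0] by simp
  then obtain B where B: "b j0 = q ^ R * B" by blast
  have "coprime A (q ^ k)"
    using q A(2) prime_imp_coprime coprime_commute by (metis coprime_power_right_iff)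
  then obtain z where z: "[A * z = 1] (mod q ^ k)"
    using coprime_iff_invertible_int by blast
  \<comment> \<open>\<open>z\<close> inverts \<open>A\<close> modulo \<open>q ^ k\<close>, so
    \<open>x0\<close> solves \<open>x * A = B\<close> there, which is the congruence at
    \<open>j0\<close> divided by \<open>q ^ R\<close>.\<close>
  define x0 where "x0 = B * z"
  define X where "X x j = x * a j - b j" for x j
  have "[B * (A * z) = B * 1] (mod q ^ k)" using z by (rule cong_scalar_left)
  then have "q ^ k dvd B * (A * z) - B * 1" by (simp only: cong_iff_dvd_diff)
  moreover have "X x0 j0 = q ^ R * (B * (A * z) - B * 1)"
    by (simp add: X_def x0_def A B algebra_simps)
  ultimately have X0j0: "q ^ k dvd X x0 j0" by simp
  \<comment> \<open>Eliminating \<open>b\<close> links the values of \<open>X x\<close> at two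
    indices. As \<open>a j0\<close> has the least valuation, divisibility by \<open>q ^ k\<close>
    passes from \<open>j0\<close> to all \<open>j\<close>.\<close>
  have rel: "a l * X x j = a j * X x l + a 1 * s j l" if "j \<in> ?J" "l \<in> ?J" for x j l
    using plucker[OF that] by (simp add: X_def algebra_simps)
  have X0: "q ^ k dvd X x0 j" if j: "j \<in> ?J" for j
  proof -
    have "q ^ (R + k) dvd a j * X x0 j0"
      unfolding power_add using Rdvd[OF j] X0j0 by (rule mult_dvd_mono)
    moreover have "q ^ R * q ^ k dvd s j j0 * a 1"
      using tri1[OF j j0 Rdvd[OF j] Rdvd[OF j0]] N by (intro mult_dvd_mono) auto
    ultimately have "q ^ (R + k) dvd (q ^ R * A) * X x0 j"
      unfolding A(1)[symmetric] rel[OF j j0] by (simp add: power_add mult.commute)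
    then show ?thesis by (rule prime_power_dvd_mult_cancel[OF q A(2)])
  qed
  \<comment> \<open>If \<open>q ^ Suc k\<close> divided \<open>X x j\<close>, then
    \<open>rel\<close> would make \<open>q ^ Suc R\<close> divide \<open>s j j0\<close>. It divides
    \<open>a j\<close> too, hence \<open>a j0\<close> by \<open>tri2\<close>, against the choice of
    \<open>R\<close>.\<close>
  have far: "\<not> q ^ Suc k dvd X x j" if j: "j \<in> ?J" and rj: "r j > R" and Xk: "q ^ k dvd X x j0" for x j
  proof
    assume "q ^ Suc k dvd X x j"
    then have "q ^ R * q ^ Suc k dvd a j0 * X x j"
      using Rdvd[OF j0] by (rule mult_dvd_mono[rotated])
    moreover have dj: "q ^ Suc R dvd a j" using pw[OF j] rj Suc_le_eq by blast
    then have "q ^ Suc R * q ^ k dvd a j * X x j0" using Xk by (rule mult_dvd_mono)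
    ultimately have "q ^ (k + Suc R) dvd a j0 * X x j - a j * X x j0"
      by (intro dvd_diff) (simp_all add: power_add ac_simps)
    then have "q ^ (k + Suc R) dvd (q ^ k * N) * s j j0"
      using rel[OF j j0, of x] N(1) by simp
    then have "q ^ Suc R dvd s j j0" by (rule prime_power_dvd_mult_cancel[OF q N(2)])
    from tri2[OF j j0 dj this] show False using pw[OF j0, of "Suc R"] by (simp add: R_def)
  qed
  show ?thesis
  proof (cases "R = 0")
    \<comment> \<open>Only indices with \<open>q dvd a j\<close> are constrained, and for
      \<open>R = 0\<close> all of these fall under \<open>far\<close>.\<close>
    case True
    have "\<not> q ^ Suc k dvd X x0 j" if j: "j \<in> ?J" and d: "q dvd a j" for j
      using far[OF j _ X0j0] pw[OF j, of 1] d True by simp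
    with X0 show ?thesis unfolding X_def by blast
  next
    case False
    define xx where "xx y = x0 + q ^ (k - R) * y" for y
    have Xx: "X (xx y) j = X x0 j + q ^ (k - R) * y * a j" for y j
      by (simp add: X_def xx_def algebra_simps)
    have Xxk: "q ^ k dvd X (xx y) j" if j: "j \<in> ?J" for y j
    proof -
      have "q ^ (k - R) * q ^ R dvd q ^ (k - R) * y * a j"
        using Rdvd[OF j] by (intro mult_dvd_mono) auto
      then have "q ^ k dvd q ^ (k - R) * y * a j"
        using Rk by (simp flip: power_add)
      with X0[OF j] show ?thesis unfolding Xx by simp
    qed
    have "\<exists>y\<in>{0..<q}. \<forall>j\<in>?J. r j = R \<longrightarrow> \<not> q ^ Suc k dvd X (xx y) j"
    proof (rule ccontr)
      assume "\<not> ?thesis"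
      then have "\<forall>y\<in>{0..<q}. \<exists>j. j \<in> ?J \<and> r j = R \<and> q ^ Suc k dvd X (xx y) j" by blast
      then obtain h where h: "\<And>y. y \<in> {0..<q} \<Longrightarrow> h y \<in> ?J \<and> r (h y) = R \<and> q ^ Suc k dvd X (xx y) (h y)"
        by metis
      \<comment> \<open>In \<open>rel\<close> for \<open>j\<close> and \<open>l\<close>, dividing
        out \<open>q ^ (R + k)\<close> leaves a term that is, modulo \<open>q\<close>, the unit
        \<open>- (y - y') * Al * Aj\<close>; hence the valuation is exactly \<open>R\<close>. The
        nonvanishing gives injectivity of \<open>h\<close>, because
        \<open>s j j = 0\<close>.\<close>
      have val: "multiplicity q (s (h y) (h y')) = R \<and> s (h y) (h y') \<noteq> 0"
        if y: "y \<in> {0..<q}" and y': "y' \<in> {0..<q}" and ne: "y \<noteq> y'" for y y'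
      proof -
        define j l where "j = h y" and "l = h y'"
        have j: "j \<in> ?J" "r j = R" "q ^ Suc k dvd X (xx y) j"
          and l: "l \<in> ?J" "r l = R" "q ^ Suc k dvd X (xx y') l"
          using h[OF y] h[OF y'] by (auto simp: j_def l_def)
        obtain Aj Al where Aj: "a j = q ^ R * Aj" "\<not> q dvd Aj" and Al: "a l = q ^ R * Al" "\<not> q dvd Al"
          using fac[OF j(1)] fac[OF l(1)] j(2) l(2) by auto
        obtain U W where U: "X (xx y) j = q ^ Suc k * U" and W: "X (xx y') l = q ^ Suc k * W"
          using j(3) l(3) by (auto elim!: dvdE)
        have Xl: "X (xx y) l = X (xx y') l + q ^ (k - R) * (y - y') * a l"
          by (simp add: Xx algebra_simps)
        have "a 1 * s j l = a l * X (xx y) j - a j * X (xx y') l - q ^ (k - R) * (y - y') * a l * a j"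
          using rel[OF j(1) l(1), of "xx y"] unfolding Xl by (simp add: algebra_simps)
        also have "\<dots> = q ^ (R + k) * (q * (Al * U - Aj * W) - (y - y') * Al * Aj)"
        proof -
          have "q ^ k = q ^ (k - R) * q ^ R" using Rk by (simp flip: power_add)
          moreover have "T * Al * (q * (Q * T) * U) - T * Aj * (q * (Q * T) * W) -
              Q * (y - y') * (T * Al) * (T * Aj) =
            T * (Q * T) * (q * (Al * U - Aj * W) - (y - y') * Al * Aj)" for Q T
            by (simp add: algebra_simps)
          ultimately show ?thesis
            unfolding U W Aj(1) Al(1) power_add power_Suc by (simp only:)
        qed
        finally have "q ^ k * (N * s j l) = q ^ k * (q ^ R * (q * (Al * U - Aj * W) - (y - y') * Al * Aj))"
          using N(1) by (simp add: power_add ac_simps)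
        then have eq: "N * s j l = q ^ R * (q * (Al * U - Aj * W) - (y - y') * Al * Aj)"
          using qn by simp
        have "\<not> q dvd y - y'"
        proof
          assume "q dvd y - y'"
          then have "y mod q = y' mod q" by (simp add: mod_eq_dvd_iff)
          with y y' ne show False by simp
        qed
        then have "\<not> q dvd (y - y') * Al * Aj"
          using Aj(2) Al(2) prime_dvd_mult_iff[OF q] by blast
        then have nd: "\<not> q dvd q * (Al * U - Aj * W) - (y - y') * Al * Aj"
          using dvd_diff_right_iff[of q "q * (Al * U - Aj * W)"] by (metis dvd_triv_left)
        have "q ^ R dvd s j l"
          using tri1[OF j(1) l(1) Rdvd[OF j(1)] Rdvd[OF l(1)]] .
        then obtain T where T: "s j l = q ^ R * T" by blast
        have "\<not> q dvd T"
        proof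
          assume "q dvd T"
          moreover have "N * T = q * (Al * U - Aj * W) - (y - y') * Al * Aj"
            using eq T qn by simp
          ultimately show False using nd by (metis dvd_mult)
        qed
        moreover from this have "T \<noteq> 0" by auto
        ultimately show ?thesis
          using T multiplicity_eqI[of q R "s j l"] qn unfolding j_def[symmetric] l_def[symmetric]
          by simp
      qed
      have ss: "s j j = 0" if "j \<in> ?J" for j using plucker[OF that that] a0[OF one] by simp
      have inj: "inj_on h {0..<q}"
      proof (rule inj_onI, rule ccontr)
        fix y y' assume y: "y \<in> {0..<q}" "y' \<in> {0..<q}" "h y = h y'" "y \<noteq> y'"
        then show False using val[OF y(1,2,4)] ss h[OF y(2)] by simp
      qed
      show False
      proof (rule equidistant[of "h ` {0..<q}" R])
        show "h ` {0..<q} \<subseteq> ?J" using h by blast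
        show "card (h ` {0..<q}) = p" using card_image[OF inj] by (simp add: q_def)
        show "R \<ge> 1" using False by simp
        show "multiplicity q (a j) = R" if "j \<in> h ` {0..<q}" for j
          using that h by (auto simp: r_def)
        show "multiplicity q (s j l) = R" if "j \<in> h ` {0..<q}" "l \<in> h ` {0..<q}" "j \<noteq> l" for j l
          using that val by blast
      qed
    qed
    then obtain y where y: "\<forall>j\<in>?J. r j = R \<longrightarrow> \<not> q ^ Suc k dvd X (xx y) j" by blast
    have "\<not> q ^ Suc k dvd X (xx y) j" if j: "j \<in> ?J" for j
      using y far[OF j _ Xxk[OF j0]] min[OF j] j by (cases "r j = R") (auto simp: R_def)
    with Xxk show ?thesis unfolding X_def by blast
  qed
qed

lemma multiplicity_int_int: "multiplicity (int p) (int x) = multiplicity p x"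
  by (simp add: multiplicity_def flip: of_nat_power)

lemma multiplicity_uminus_right_int: "multiplicity p (- x) = multiplicity p (x :: int)"
  by (simp add: multiplicity_def)

section \<open>The two conditions, and vectors for the whole frieze\<close>

definition triangle_condition :: "nat \<Rightarrow> (nat \<Rightarrow> nat \<Rightarrow> nat) \<Rightarrow> bool" where
  "triangle_condition n c \<longleftrightarrow> (\<forall>i j k. i < j \<and> j < k \<and> k < n \<longrightarrow>
     gcd (c i j) (c j k) = gcd (c j k) (c i k) \<and> gcd (c j k) (c i k) = gcd (c i j) (c i k))"

definition prime_condition :: "nat \<Rightarrow> (nat \<Rightarrow> nat \<Rightarrow> nat) \<Rightarrow> bool" where
  "prime_condition n c \<longleftrightarrow> (\<forall>p S. prime p \<and> p < n \<and> S \<subseteq> {..<n} \<and> card S = p + 1 \<longrightarrow>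
     (\<forall>x\<in>subpolygon_labels c S. \<not> p dvd x) \<or>
     \<not> (\<forall>x\<in>subpolygon_labels c S. \<forall>y\<in>subpolygon_labels c S. multiplicity p x = multiplicity p y))"

text \<open>Equality of the three gcds means that a common divisor of two sides divides the third.
  Symmetry of the labels frees this from the order of the vertices.\<close>

lemma triangle_condition_dvd:
  assumes tri: "triangle_condition n c"
    and sym: "\<And>i j. i < n \<Longrightarrow> j < n \<Longrightarrow> i \<noteq> j \<Longrightarrow> c i j = c j i"
    and ijk: "i < n" "j < n" "k < n" "i \<noteq> j" "j \<noteq> k" "i \<noteq> k"
    and d: "d dvd c i j" "d dvd c i k"
  shows "d dvd c j k"
proof -
  have *: "(d dvd c x y \<and> d dvd c y z \<longrightarrow> d dvd c x z) \<and> (d dvd c x y \<and> d dvd c x z \<longrightarrow> d dvd c y z)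
      \<and> (d dvd c y z \<and> d dvd c x z \<longrightarrow> d dvd c x y)"
    if "x < y" "y < z" "z < n" for x y z
  proof -
    have "gcd (c x y) (c y z) = gcd (c y z) (c x z)" "gcd (c y z) (c x z) = gcd (c x y) (c x z)"
      using tri that unfolding triangle_condition_def by blast+
    then show ?thesis by (metis gcd_greatest_iff)
  qed
  have s: "c j i = c i j" "c k i = c i k" "c k j = c j k" using sym ijk by auto
  consider "i < j" "j < k" | "i < k" "k < j" | "j < i" "i < k" | "j < k" "k < i" | "k < i" "i < j" | "k < j" "j < i"
    using ijk by linarith
  then show ?thesis
    using *[of i j k] *[of i k j] *[of j i k] *[of j k i] *[of k i j] *[of k j i] ijk d s
    by cases simp_all
qed

text \<open>Chinese remainder theorem with moduli one power of \<open>p\<close> above what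
  divisibility by \<open>N\<close> demands, so that the non-divisibility also depends only on the
  residue of \<open>x\<close>.\<close>

lemma exists_global_solution:
  fixes N :: nat and a b :: "nat \<Rightarrow> int"
  assumes N: "N > 0"
    and local: "\<And>p. prime p \<Longrightarrow> \<exists>x. \<forall>j\<in>J. int p ^ multiplicity p N dvd x * a j - b j \<and>
      (int p dvd a j \<longrightarrow> \<not> int p ^ Suc (multiplicity p N) dvd x * a j - b j)"
  shows "\<exists>x. \<forall>j\<in>J. int N dvd x * a j - b j \<and>
    (\<forall>p. prime p \<and> p dvd N \<and> int p dvd a j \<longrightarrow> \<not> int p ^ Suc (multiplicity p N) dvd x * a j - b j)"
proof -
  obtain u where u: "\<And>p j. prime p \<Longrightarrow> j \<in> J \<Longrightarrow> int p ^ multiplicity p N dvd u p * a j - b j \<and>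
      (int p dvd a j \<longrightarrow> \<not> int p ^ Suc (multiplicity p N) dvd u p * a j - b j)"
    using local by metis
  define m where "m p = p ^ Suc (multiplicity p N)" for p
  define v where "v p = nat (u p mod int (m p))" for p
  have "coprime (m p) (m p')" if "p \<in> prime_factors N" "p' \<in> prime_factors N" "p \<noteq> p'" for p p'
    using that primes_coprime[of p p'] unfolding m_def
    by (intro coprime_power_left_iff[THEN iffD2] coprime_power_right_iff[THEN iffD2] disjI1)
       (auto dest: in_prime_factors_imp_prime)
  then obtain x where x: "\<And>p. p \<in> prime_factors N \<Longrightarrow> [x = v p] (mod m p)"
    using chinese_remainder_nat[of "prime_factors N" m v] by auto
  have shift: "int p ^ Suc (multiplicity p N) dvd (int x * a j - b j) - (u p * a j - b j)"
    if p: "prime p" "p dvd N" for p j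
  proof -
    have "p \<in> prime_factors N" using p N by (simp add: prime_factors_dvd)
    then have "[int x = int (v p)] (mod int (m p))"
      using x cong_int_iff by blast
    moreover have "int (v p) = u p mod int (m p)"
      using p by (simp add: v_def m_def prime_gt_0_nat)
    ultimately have "[int x = u p] (mod int (m p))" by (simp add: cong_def)
    then have "int (m p) dvd (int x - u p) * a j" by (simp add: cong_iff_dvd_diff)
    then show ?thesis by (simp add: m_def algebra_simps)
  qed
  have "int N dvd int x * a j - b j" if j: "j \<in> J" for j
  proof (cases "int x * a j - b j = 0")
    case nz: False
    show ?thesis
    proof (rule multiplicity_le_imp_dvd)
      fix q :: int assume q: "prime q"
      define p where "p = nat q"
      have p: "prime p" using iffD1[OF prime_int_nat_transfer q] by (simp add: p_def)
      have qp: "q = int p" using prime_ge_0_int[OF q] by (simp add: p_def)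
      show "multiplicity q (int N) \<le> multiplicity q (int x * a j - b j)"
      proof (cases "p dvd N")
        case True
        have "int p ^ multiplicity p N dvd (int x * a j - b j) - (u p * a j - b j)"
          using shift[of p j] p True by (meson dvd_trans le_imp_power_dvd lessI less_imp_le)
        moreover have "int p ^ multiplicity p N dvd u p * a j - b j"
          using u[OF p j] by blast
        ultimately have "int p ^ multiplicity p N dvd int x * a j - b j"
          using dvd_diff_left_iff by blast
        then have "multiplicity p N \<le> multiplicity q (int x * a j - b j)"
          unfolding qp using nz p by (intro multiplicity_geI) auto
        then show ?thesis by (simp add: qp multiplicity_int_int)
      next
        case False
        then show ?thesis by (simp add: qp multiplicity_int_int not_dvd_imp_multiplicity_0)
      qed
    qed (use N in simp)
  qed simp
  moreover have "\<not> int p ^ Suc (multiplicity p N) dvd int x * a j - b j"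
    if "j \<in> J" "prime p" "p dvd N" "int p dvd a j" for j p
    using u[OF that(2,1)] that(4) shift[OF that(2,3), of j] dvd_diff_right_iff by blast
  ultimately show ?thesis by blast
qed

lemma exists_primitive_representation:
  assumes fr: "frieze {0<..} n c" and tri: "triangle_condition n c" and pr: "prime_condition n c"
  shows "\<exists>V. (\<forall>i<n. primitive (V i)) \<and> (\<forall>i j. i < j \<and> j < n \<longrightarrow> det2 (V i) (V j) = int (c i j))"
proof -
  have n: "n \<ge> 3" and pos: "\<And>i j. i < n \<Longrightarrow> j < n \<Longrightarrow> i \<noteq> j \<Longrightarrow> c i j > 0"
    and sym: "\<And>i j. i < n \<Longrightarrow> j < n \<Longrightarrow> i \<noteq> j \<Longrightarrow> c i j = c j i"
    and pt: "\<And>i j k l. i < j \<Longrightarrow> j < k \<Longrightarrow> k < l \<Longrightarrow> l < n \<Longrightarrow> c i k * c j l = c i l * c j k + c i j * c k l"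
    using fr unfolding frieze_def greaterThan_iff by blast+
  let ?J = "{1..<n}"
  define N where "N = c 0 1"
  define a where "a j = int (c 0 j)" for j
  \<comment> \<open>The signs make \<open>s\<close> antisymmetric, so the Ptolemy relation through
    the vertices 0 and 1 takes one form for all \<open>j\<close> and \<open>l\<close>.\<close>
  define s where "s i j = (if i < j then int (c i j) else if j < i then - int (c i j) else 0)" for i j
  define b where "b = s 1"
  have N0: "N > 0" using pos n by (simp add: N_def)
  have aN: "a 1 = int N" by (simp add: a_def N_def)
  have plucker1: "a 1 * s j l = a j * b l - a l * b j" if "1 \<le> j" "j < l" "l < n" for j l
  proof (cases "j = 1")
    case True
    then show ?thesis by (simp add: b_def s_def)
  next
    case False
    then have "int (c 0 j * c 1 l) = int (c 0 l * c 1 j + c 0 1 * c j l)"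
      using pt[of 0 1 j l] that by simp
    then show ?thesis using False that by (simp add: a_def b_def s_def)
  qed
  have anti: "s l j = - s j l" if "j < n" "l < n" for j l
    using sym that by (auto simp: s_def)
  have plucker: "a 1 * s j l = a j * b l - a l * b j" if "j \<in> ?J" "l \<in> ?J" for j l
  proof (cases j l rule: linorder_cases)
    case less then show ?thesis using plucker1 that by simp
  next
    case equal then show ?thesis by (simp add: s_def)
  next
    case greater then show ?thesis using plucker1[of l j] anti[of l j] that by simp
  qed
  have dvd_s: "d dvd s j l \<longleftrightarrow> nat \<bar>d\<bar> dvd c j l" if "j \<noteq> l" for d j l
    using that by (simp add: s_def)
  have tri1: "d dvd s j l" if "j \<in> ?J" "l \<in> ?J" "d dvd a j" "d dvd a l" for d j l
  proof (cases "j = l")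
    case False
    then show ?thesis
      using triangle_condition_dvd[OF tri sym, of 0 j l "nat \<bar>d\<bar>"] that by (auto simp: dvd_s a_def)
  qed (simp add: s_def)
  have tri2: "d dvd a l" if "j \<in> ?J" "l \<in> ?J" "d dvd a j" "d dvd s j l" for d j l
  proof (cases "j = l")
    case False
    then show ?thesis
      using triangle_condition_dvd[OF tri sym, of j 0 l "nat \<bar>d\<bar>"] that sym[of 0 j]
      by (auto simp: dvd_s a_def)
  qed (use that in simp)
  have local: "\<exists>x. \<forall>j\<in>?J. int p ^ multiplicity p N dvd x * a j - b j \<and>
      (int p dvd a j \<longrightarrow> \<not> int p ^ Suc (multiplicity p N) dvd x * a j - b j)"
    if p: "prime p" for p
  proof -
    have mN: "multiplicity p N = multiplicity (int p) (a 1)"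
      unfolding aN by (rule multiplicity_int_int[symmetric])
    show ?thesis
      unfolding mN
    proof (rule exists_local_solution[where a = a and b = b and s = s and n = n, OF p _ _ _ plucker tri1 tri2])
      show "n \<ge> 2" using n by simp
      show "b 1 = 0" by (simp add: b_def s_def)
      show "a j \<noteq> 0" if "j \<in> ?J" for j using pos[of 0 j] that by (simp add: a_def)
    next
      fix T r
      assume T: "T \<subseteq> ?J" "card T = p" and r: "r \<ge> 1"
        and ma: "\<And>j. j \<in> T \<Longrightarrow> multiplicity (int p) (a j) = r"
        and ms: "\<And>j l. j \<in> T \<Longrightarrow> l \<in> T \<Longrightarrow> j \<noteq> l \<Longrightarrow> multiplicity (int p) (s j l) = r"
      have fT: "finite T" using T finite_subset by blast
      have zT: "0 \<notin> T" using T by auto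
      have "p \<le> n - 1" using card_mono[OF _ T(1)] T(2) by simp
      then have pn: "p < n" using n by linarith
      have cT: "multiplicity p (c 0 j) = r" if "j \<in> T" for j
        using ma[OF that] by (simp add: a_def multiplicity_int_int)
      have cTT: "multiplicity p (c j l) = r" if "j \<in> T" "l \<in> T" "j \<noteq> l" for j l
        using ms[OF that] that
        by (auto simp: s_def multiplicity_int_int multiplicity_uminus_right_int split: if_splits)
      \<comment> \<open>Adding vertex 0 to \<open>T\<close> yields a
        \<open>(p + 1)\<close>-subpolygon all of whose labels have the same positive valuation
        \<open>r\<close>, which \<open>prime_condition\<close> forbids.\<close>
      have all: "multiplicity p x = r" if x: "x \<in> subpolygon_labels c (insert 0 T)" for x
      proof -
        obtain i j where ij: "x = c i j" "i \<in> insert 0 T" "j \<in> insert 0 T" "i \<noteq> j"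
          using x unfolding subpolygon_labels_def by blast
        then have "i < n" "j < n" using T n by auto
        then show ?thesis using ij cT cTT sym[of i j] by (metis insertE)
      qed
      obtain t where t: "t \<in> T" using T(2) p by (metis all_not_in_conv card.empty not_prime_0)
      then have lab: "c 0 t \<in> subpolygon_labels c (insert 0 T)"
        using zT unfolding subpolygon_labels_def by blast
      have "p dvd c 0 t"
        using cT[OF t] r not_dvd_imp_multiplicity_0[of p "c 0 t"] by linarith
      moreover have "insert 0 T \<subseteq> {..<n}" "card (insert 0 T) = p + 1"
        using T n zT fT by auto
      ultimately show False using pr p pn all lab unfolding prime_condition_def by metis
    qed
  qed
  obtain x where x: "\<And>j. j \<in> ?J \<Longrightarrow> int N dvd x * a j - b j"
    and xp: "\<And>j p. j \<in> ?J \<Longrightarrow> prime p \<Longrightarrow> p dvd N \<Longrightarrow> int p dvd a j \<Longrightarrow>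
       \<not> int p ^ Suc (multiplicity p N) dvd x * a j - b j"
    using exists_global_solution[OF N0 local] by blast
  define X where "X j = (x * a j - b j) div int N" for j
  have X: "x * a j - b j = int N * X j" if "j \<in> ?J" for j
    using x[OF that] by (simp add: X_def)
  \<comment> \<open>At \<open>j = 1\<close> the general formula gives the first coordinate
    \<open>x\<close>, since \<open>b 1 = 0\<close>.\<close>
  define V where "V j = (if j = 0 then (1, 0) else (X j, a j))" for j
  have "primitive (V j)" if "j < n" for j
  proof (cases "j = 0")
    case False
    then have j: "j \<in> ?J" using that by simp
    have "coprime (X j) (a j)"
    proof (rule ccontr)
      assume "\<not> coprime (X j) (a j)"
      then have "\<not> is_unit (gcd (X j) (a j))" unfolding is_unit_gcd .
      moreover have "gcd (X j) (a j) \<noteq> 0" using pos[of 0 j] j by (simp add: a_def)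
      ultimately obtain q where "prime q" "q dvd gcd (X j) (a j)"
        using prime_divisorE by blast
      then obtain p where p: "prime p" "int p dvd X j" "int p dvd a j"
        by (metis gcd_greatest_iff prime_int_nat_transfer nat_0_le prime_ge_0_int)
      \<comment> \<open>If \<open>p\<close> divides \<open>N\<close>, then \<open>N * X j\<close>
        has one factor \<open>p\<close> more than \<open>xp\<close> permits. If not,
        \<open>p\<close> divides \<open>c 1 j\<close> and \<open>c 0 j\<close>, hence
        \<open>N = c 0 1\<close> by the triangle condition.\<close>
      show False
      proof (cases "p dvd N")
        case True
        have "int p ^ multiplicity p N dvd int N"
          using multiplicity_dvd[of p N] by (metis int_dvd_int_iff of_nat_power)
        then have "int p * int p ^ multiplicity p N dvd X j * int N"
          using p(2) by (rule mult_dvd_mono[rotated])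
        then show False using xp[OF j p(1) True p(3)] X[OF j] by (simp add: mult.commute)
      next
        case pN: False
        have "j \<noteq> 1" using pN p(3) aN by auto
        have "int p dvd x * a j - b j" using X[OF j] p(2) by simp
        then have "int p dvd b j" using p(3) by (metis dvd_diff_right_iff dvd_mult)
        then have "p dvd c 1 j" "p dvd c 0 j"
          using p(3) j \<open>j \<noteq> 1\<close> by (auto simp: b_def s_def a_def)
        then have "p dvd c 0 1"
          using triangle_condition_dvd[OF tri sym, of j 0 1 p] sym[of 0 j] sym[of 1 j] j \<open>j \<noteq> 1\<close> by auto
        with pN show False by (simp add: N_def)
      qed
    qed
    then show ?thesis using False by (simp add: V_def primitive_def)
  qed (simp add: V_def primitive_def)
  moreover have "det2 (V i) (V j) = int (c i j)" if ij: "i < j" "j < n" for i j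
  proof (cases "i = 0")
    case False
    then have J: "i \<in> ?J" "j \<in> ?J" using ij by auto
    have "int N * det2 (V i) (V j) = (x * a i - b i) * a j - (x * a j - b j) * a i"
      using X[OF J(1)] X[OF J(2)] False ij by (simp add: V_def det2_def algebra_simps)
    also have "\<dots> = int N * s i j" using plucker[OF J] aN by (simp add: algebra_simps)
    finally show ?thesis using N0 ij by (simp add: s_def)
  qed (use ij in \<open>simp add: V_def det2_def a_def\<close>)
  ultimately show ?thesis by blast
qed

section \<open>Conway-Coxeter friezes and primitive vectors\<close>

lemma subpolygon_of_conway_coxeter_if_primitive_representation:
  assumes fr: "frieze {0<..} n c"
    and prim: "\<And>i. i < n \<Longrightarrow> primitive (V i)"
    and det: "\<And>i j. i < j \<Longrightarrow> j < n \<Longrightarrow> det2 (V i) (V j) = int (c i j)"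
  shows "\<exists>m e. conway_coxeter_frieze m e \<and> appears_as_subpolygon n c m e"
proof -
  have n: "n \<ge> 3" and pos: "\<And>i j. i < n \<Longrightarrow> j < n \<Longrightarrow> i \<noteq> j \<Longrightarrow> c i j > 0"
    and sym: "\<And>i j. i < n \<Longrightarrow> j < n \<Longrightarrow> i \<noteq> j \<Longrightarrow> c i j = c j i"
    using fr unfolding frieze_def greaterThan_iff by blast+
  have "primitive (- V 0)" using prim[of 0] n by (simp add: primitive_def)
  moreover have "det2 (V i) (- V 0) > 0" if "0 < i" "i < n" for i
    using det[of 0 i] pos[of 0 i] that by (simp add: det2_swap[of "V i"])
  ultimately have "vector_fan n (V(n := - V 0))"
    unfolding vector_fan_def using n prim pos det by (auto simp: le_less)
  then obtain m W f where fan: "vector_fan m W" and one: "\<And>i. i < m \<Longrightarrow> det2 (W i) (W (Suc i)) = 1"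
    and f: "strict_mono_on {..<n} f" "f ` {..<n} \<subseteq> {..<m}" and Wf: "\<And>i. i < n \<Longrightarrow> W (f i) = V i"
    using vector_fan_refine[of n "V(n := - V 0)"] by auto
  define e where "e i j = nat \<bar>det2 (W i) (W j)\<bar>" for i j
  have m: "m \<ge> 3" and Wm: "W m = - W 0" using fan unfolding vector_fan_def by auto
  have posW: "det2 (W i) (W j) > 0" if "i < j" "j < m" for i j
    using fan that unfolding vector_fan_def by auto
  have esym: "e i j = e j i" for i j
    by (simp add: e_def det2_swap[of "W j" "W i"])
  have e: "int (e i j) = det2 (W i) (W j)" if "i < j" "j < m" for i j
    using posW[OF that] by (simp add: e_def)
  have epos: "e i j > 0" if "i < m" "j < m" "i \<noteq> j" for i j
    using that posW[of i j] posW[of j i] esym[of i j] by (cases "i < j") (auto simp: e_def)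
  have "e i k * e j l = e i l * e j k + e i j * e k l" if "i < j" "j < k" "k < l" "l < m" for i j k l
  proof -
    have "int (e i k * e j l) = int (e i l * e j k + e i j * e k l)"
      using that det2_plucker[of "W i" "W k" "W j" "W l"] by (simp add: e)
    then show ?thesis by (simp only: of_nat_eq_iff)
  qed
  then have "frieze {0<..} m e"
    unfolding frieze_def using m epos esym by auto
  moreover have "e i ((i + 1) mod m) = 1" if "i < m" for i
  proof (cases "Suc i = m")
    case True
    then have "det2 (W i) (W 0) = - 1" using one[OF that] Wm by simp
    then show ?thesis using True by (simp add: e_def)
  next
    case False
    then show ?thesis using that one[OF that] by (simp add: e_def)
  qed
  ultimately have "conway_coxeter_frieze m e" unfolding conway_coxeter_frieze_def by blast
  moreover have "appears_as_subpolygon n c m e"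
    unfolding appears_as_subpolygon_def
  proof (intro exI conjI allI impI)
    show "f ` {..<n} \<subseteq> {..<m}" by (rule f(2))
    show "bij_betw f {..<n} (f ` {..<n})"
      using strict_mono_on_imp_inj_on[OF f(1)] by (simp add: inj_on_imp_bij_betw)
    show "cyclically_ordered (f i) (f j) (f k)"
      if "i < n" "j < n" "k < n" "cyclically_ordered i j k" for i j k
      using that f(1) unfolding cyclically_ordered_def strict_mono_on_def by auto
    show "c i j = e (f i) (f j)" if "i < n" "j < n" "i \<noteq> j" for i j
      using that det[of i j] det[of j i] sym[of i j] esym[of "f i" "f j"]
      by (cases "i < j") (auto simp: e_def Wf)
  qed
  ultimately show ?thesis by blast
qed

text \<open>The boundary labels 1 provide each vector with a partner, hence primitivity. Absolute
  values appear because a relabelling that keeps only the cyclic order can reverse the sign of a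
  determinant.\<close>

lemma conway_coxeter_primitive_representation:
  assumes "conway_coxeter_frieze m e"
  shows "\<exists>V. (\<forall>i<m. primitive (V i)) \<and>
    (\<forall>i<m. \<forall>j<m. i \<noteq> j \<longrightarrow> int (e i j) = \<bar>det2 (V i) (V j)\<bar>)"
proof -
  have m: "m \<ge> 3"
    and sym: "\<And>i j. i < m \<Longrightarrow> j < m \<Longrightarrow> i \<noteq> j \<Longrightarrow> e i j = e j i"
    and pt: "\<And>i j k l. i < j \<Longrightarrow> j < k \<Longrightarrow> k < l \<Longrightarrow> l < m \<Longrightarrow> e i k * e j l = e i l * e j k + e i j * e k l"
    and one: "\<And>i. i < m \<Longrightarrow> e i ((i + 1) mod m) = 1"
    using assms unfolding conway_coxeter_frieze_def frieze_def greaterThan_iff by blast+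
  have e01: "e 0 1 = 1" using one[of 0] m by simp
  \<comment> \<open>The vertices 0 and 1 are set apart because \<open>e 0 0\<close> and
    \<open>e 1 1\<close> carry no meaning, and because \<open>V 0\<close> needs the sign opposite to
    \<open>- int (e 1 0)\<close>.\<close>
  define V where "V j = (if j = 0 then (1, 0) else if j = 1 then (0, 1)
    else (- int (e 1 j), int (e 0 j)))" for j
  have V: "det2 (V i) (V j) = int (e i j)" if "i < j" "j < m" for i j
  proof (cases "i \<le> 1")
    case True
    then show ?thesis using that e01 by (auto simp: V_def det2_def le_Suc_eq)
  next
    case False
    then have "int (e 0 i * e 1 j) = int (e 0 j * e 1 i + e 0 1 * e i j)"
      using pt[of 0 1 i j] that by simp
    then show ?thesis using False that e01 by (simp add: V_def det2_def algebra_simps)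
  qed
  have "primitive (V i)" if i: "i < m" for i
  proof (cases "Suc i = m")
    case True
    then have "e i 0 = 1" using one[OF i] by simp
    then have "det2 (V i) (- V 0) = 1"
      using V[of 0 i] sym[of 0 i] True m by (simp add: det2_swap[of "V i"])
    then show ?thesis using primitive_iff_det2 by blast
  next
    case False
    then have "det2 (V i) (V (Suc i)) = 1" using one[OF i] V[of i "Suc i"] i by simp
    then show ?thesis using primitive_iff_det2 by blast
  qed
  moreover have "int (e i j) = \<bar>det2 (V i) (V j)\<bar>" if "i < m" "j < m" "i \<noteq> j" for i j
    using that V[of i j] V[of j i] sym[of i j] det2_swap[of "V i" "V j"] by (cases "i < j") auto
  ultimately show ?thesis by blast
qed

lemma conditions_if_primitive_representation:
  assumes prim: "\<And>i. i < n \<Longrightarrow> primitive (V i)"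
    and rep: "\<And>i j. i < n \<Longrightarrow> j < n \<Longrightarrow> i \<noteq> j \<Longrightarrow> int (c i j) = \<bar>det2 (V i) (V j)\<bar>"
    and pos: "\<And>i j. i < n \<Longrightarrow> j < n \<Longrightarrow> i \<noteq> j \<Longrightarrow> c i j > 0"
  shows "triangle_condition n c" "prime_condition n c"
proof -
  have dvd: "d dvd c i j \<longleftrightarrow> int d dvd det2 (V i) (V j)" if "i < n" "j < n" "i \<noteq> j" for d i j
    by (metis rep[OF that] dvd_abs_iff int_dvd_int_iff)
  have swap: "int d dvd det2 (V i) (V j) \<longleftrightarrow> int d dvd det2 (V j) (V i)" for d i j
    by (metis det2_swap dvd_minus_iff)
  show "triangle_condition n c"
    unfolding triangle_condition_def
  proof (intro allI impI)
    fix i j k assume "i < j \<and> j < k \<and> k < n"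
    then have lt: "i < n" "j < n" "k < n" "i \<noteq> j" "j \<noteq> k" "i \<noteq> k" by auto
    have "d dvd c i j \<Longrightarrow> d dvd c j k \<Longrightarrow> d dvd c i k" "d dvd c i j \<Longrightarrow> d dvd c i k \<Longrightarrow> d dvd c j k"
      "d dvd c j k \<Longrightarrow> d dvd c i k \<Longrightarrow> d dvd c i j" for d
      using lt dvd_det2_trans[OF prim[of j], of "int d" "V i" "V k"]
        dvd_det2_trans[OF prim[of i], of "int d" "V j" "V k"]
        dvd_det2_trans[OF prim[of k], of "int d" "V i" "V j"]
        swap[of d j i] swap[of d k i] swap[of d k j]
      by (auto simp: dvd)
    then show "gcd (c i j) (c j k) = gcd (c j k) (c i k) \<and> gcd (c j k) (c i k) = gcd (c i j) (c i k)"
      by (intro conjI dvd_antisym gcd_greatest) (meson gcd_dvd1 gcd_dvd2)+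
  qed
  show "prime_condition n c"
    unfolding prime_condition_def
  proof (intro allI impI, rule ccontr)
    fix p S
    assume S: "prime p \<and> p < n \<and> S \<subseteq> {..<n} \<and> card S = p + 1"
      and "\<not> ((\<forall>x\<in>subpolygon_labels c S. \<not> p dvd x) \<or>
        \<not> (\<forall>x\<in>subpolygon_labels c S. \<forall>y\<in>subpolygon_labels c S. multiplicity p x = multiplicity p y))"
    then obtain x where x: "x \<in> subpolygon_labels c S" "p dvd x"
      and eq: "\<And>y. y \<in> subpolygon_labels c S \<Longrightarrow> multiplicity p y = multiplicity p x" by blast
    define r where "r = multiplicity p x"
    have pu: "\<not> is_unit p" using S by auto
    \<comment> \<open>Equal valuations become statements about powers of \<open>p\<close>, the form
      in which \<open>card_equidistant_vectors_le\<close> bounds \<open>card S\<close> by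
      \<open>p\<close>.\<close>
    have m: "p ^ k dvd c i j \<longleftrightarrow> k \<le> r" if "i \<in> S" "j \<in> S" "i \<noteq> j" for i j k
    proof -
      have "c i j \<in> subpolygon_labels c S" using that unfolding subpolygon_labels_def by blast
      then have "multiplicity p (c i j) = r" using eq by (simp add: r_def)
      moreover have "c i j \<noteq> 0" using pos[of i j] that S by auto
      ultimately show ?thesis using power_dvd_iff_le_multiplicity[OF _ pu] by blast
    qed
    obtain i j where ij: "x = c i j" "i \<in> S" "j \<in> S" "i \<noteq> j"
      using x(1) unfolding subpolygon_labels_def by blast
    then have r: "r \<ge> 1" using m[OF ij(2-4), of 1] x(2) by simp
    have "card S \<le> p"
    proof (rule card_equidistant_vectors_le[where V = V and r = r])
      show "prime p" "S \<noteq> {}" "r \<ge> 1" using S ij r by auto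
      show "finite S" using S finite_subset by blast
      show "primitive (V i)" if "i \<in> S" for i using that S prim by blast
      show "int p ^ r dvd det2 (V i) (V j)" if "i \<in> S" "j \<in> S" for i j
        using that m[OF that, of r] dvd[of i j "p ^ r"] S by (cases "i = j") auto
      show "\<not> int p ^ Suc r dvd det2 (V i) (V j)" if "i \<in> S" "j \<in> S" "i \<noteq> j" for i j
      proof -
        have "\<not> p ^ Suc r dvd c i j" unfolding m[OF that] by simp
        moreover have "i < n" "j < n" using that S by auto
        ultimately show ?thesis using dvd[of i j "p ^ Suc r"] that(3) by simp
      qed
    qed
    with S show False by simp
  qed
qed

theorem theorem3p2:
  fixes n :: nat and c :: "nat \<Rightarrow> nat \<Rightarrow> nat"
  assumes "frieze {0<..} n c"
  shows "(\<exists>m e. conway_coxeter_frieze m e \<and> appears_as_subpolygon n c m e) \<longleftrightarrow>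
     (\<forall>i j k. i < j \<and> j < k \<and> k < n \<longrightarrow>
        gcd (c i j) (c j k) = gcd (c j k) (c i k) \<and>
        gcd (c j k) (c i k) = gcd (c i j) (c i k)) \<and>
     (\<forall>p S. prime p \<and> p < n \<and> S \<subseteq> {..<n} \<and> card S = p + 1 \<longrightarrow>
        (\<forall>x\<in>subpolygon_labels c S. \<not> p dvd x) \<or>
        \<not> (\<forall>x\<in>subpolygon_labels c S. \<forall>y\<in>subpolygon_labels c S.
             multiplicity p x = multiplicity p y))"
  unfolding triangle_condition_def[symmetric] prime_condition_def[symmetric]
proof
  assume "\<exists>m e. conway_coxeter_frieze m e \<and> appears_as_subpolygon n c m e"
  then obtain m e where e: "conway_coxeter_frieze m e" and app: "appears_as_subpolygon n c m e"
    by blast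
  from app obtain S f where S: "S \<subseteq> {..<m}"
    and f: "bij_betw f {..<n} S" and ce: "\<forall>i<n. \<forall>j<n. i \<noteq> j \<longrightarrow> c i j = e (f i) (f j)"
    unfolding appears_as_subpolygon_def by (elim exE conjE) (rule that)
  obtain V where V: "\<And>i. i < m \<Longrightarrow> primitive (V i)"
    "\<And>i j. i < m \<Longrightarrow> j < m \<Longrightarrow> i \<noteq> j \<Longrightarrow> int (e i j) = \<bar>det2 (V i) (V j)\<bar>"
    using conway_coxeter_primitive_representation[OF e] by blast
  have fm: "f i < m" if "i < n" for i using f S that by (auto simp: bij_betw_def)
  have finj: "f i \<noteq> f j" if "i < n" "j < n" "i \<noteq> j" for i j
    using f that by (auto simp: bij_betw_def inj_on_def)
  have pos: "c i j > 0" if "i < n" "j < n" "i \<noteq> j" for i j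
    using assms that unfolding frieze_def greaterThan_iff by blast
  have rep: "int (c i j) = \<bar>det2 ((V \<circ> f) i) ((V \<circ> f) j)\<bar>" if "i < n" "j < n" "i \<noteq> j" for i j
    using V(2)[OF fm fm finj] that ce by simp
  have prim: "primitive ((V \<circ> f) i)" if "i < n" for i using V(1)[OF fm] that by simp
  show "triangle_condition n c \<and> prime_condition n c"
    using conditions_if_primitive_representation[of n "V \<circ> f" c] prim rep pos by blast
next
  assume "triangle_condition n c \<and> prime_condition n c"
  then obtain V where "\<forall>i<n. primitive (V i)" "\<forall>i j. i < j \<and> j < n \<longrightarrow> det2 (V i) (V j) = int (c i j)"
    using exists_primitive_representation[OF assms] by blast
  then show "\<exists>m e. conway_coxeter_frieze m e \<and> appears_as_subpolygon n c m e"
    by (intro subpolygon_of_conway_coxeter_if_primitive_representation[OF assms]) auto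
qed

end
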